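(* If $I$ is a proper ideal of a TAF-ring $R$, then the set $\mathrm{Min}(I)$ of prime ideals of $R$ minimal over $I$ is finite.
   Context: All rings are commutative with identity. An ideal $I$ of a ring $R$ is a 2-absorbing ideal (TA-ideal) if whenever $a,b,c\in R$ and $abc\in I$, then $ab\in I$ or $ac\in I$ or $bc\in I$. A TA-factorization of an ideal $I$ is an expression $I=J_1\cdots J_n$ as a product of proper TA-ideals. $R$ is a TAF-ring if every proper ideal of $R$ has a TA-factorization. *)

theory Defs
  imports "HOL-Algebra.Ideal_Product"
begin

text \<open>The unit ideal counts as 2-absorbing here;
  properness is required separately in factorizations.\<close>

definition ta_ideal :: "('a, 'b) ring_scheme \<Rightarrow> 'a set \<Rightarrow> bool" where
  "ta_ideal R I \<longleftrightarrow> ideal I R \<and>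
     (\<forall>a\<in>carrier R. \<forall>b\<in>carrier R. \<forall>c\<in>carrier R.
        a \<otimes>\<^bsub>R\<^esub> b \<otimes>\<^bsub>R\<^esub> c \<in> I \<longrightarrow>
          a \<otimes>\<^bsub>R\<^esub> b \<in> I \<or> a \<otimes>\<^bsub>R\<^esub> c \<in> I \<or> b \<otimes>\<^bsub>R\<^esub> c \<in> I)"

definition proper_ideal :: "('a, 'b) ring_scheme \<Rightarrow> 'a set \<Rightarrow> bool" where
  "proper_ideal R I \<longleftrightarrow> ideal I R \<and> I \<noteq> carrier R"

text \<open>The base case \<open>carrier R\<close> is the neutral element of ideal multiplication.\<close>

definition ideal_prod_list :: "('a, 'b) ring_scheme \<Rightarrow> 'a set list \<Rightarrow> 'a set" where
  "ideal_prod_list R Js = foldr (ideal_prod R) Js (carrier R)"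

definition ta_factorization :: "('a, 'b) ring_scheme \<Rightarrow> 'a set \<Rightarrow> 'a set list \<Rightarrow> bool" where
  "ta_factorization R I Js \<longleftrightarrow>
     Js \<noteq> [] \<and> (\<forall>J\<in>set Js. proper_ideal R J \<and> ta_ideal R J) \<and> I = ideal_prod_list R Js"

definition taf_ring :: "('a, 'b) ring_scheme \<Rightarrow> bool" where
  "taf_ring R \<longleftrightarrow> cring R \<and> (\<forall>I. proper_ideal R I \<longrightarrow> (\<exists>Js. ta_factorization R I Js))"

definition minimal_primes :: "('a, 'b) ring_scheme \<Rightarrow> 'a set \<Rightarrow> 'a set set" where
  "minimal_primes R I =
     {P. primeideal P R \<and> I \<subseteq> P \<and>
         (\<forall>Q. primeideal Q R \<and> I \<subseteq> Q \<and> Q \<subseteq> P \<longrightarrow> Q = P)}"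

end

theory Submission
  imports Defs "HOL-Algebra.Ring_Divisibility"
begin

text \<open>
  A prime minimal over a product of ideals is minimal over one of the factors, so it suffices that a
  2-absorbing ideal \<open>J\<close> has at most two minimal primes. For distinct minimal primes \<open>P\<close>, \<open>Q\<close> of \<open>J\<close>,
  the multiplicative set generated by the two complements meets \<open>J\<close>: otherwise some prime over \<open>J\<close>
  would lie in \<open>P \<inter> Q\<close>. Hence \<open>st \<in> J\<close> for some \<open>s \<notin> P\<close>, \<open>t \<notin> Q\<close>. Given three distinct minimal
  primes, multiplying such elements yields \<open>a\<close>, \<open>b\<close>, \<open>c\<close>, each outside one of the primes, with
  \<open>ab\<close>, \<open>ac\<close>, \<open>bc \<in> J\<close>. Then \<open>(a + b)(a + c)(b + c) \<in> J\<close>, while no product of two of these factors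
  is in \<open>J\<close>.
\<close>

text \<open>Zorn's lemma gives an ideal maximal among those that contain \<open>J\<close> and miss
  the multiplicative set \<open>S\<close>; this maximality forces primality.\<close>

lemma (in cring) primeideal_avoiding_exists:
  assumes J: "ideal J R" and one: "\<one> \<in> S"
    and mult: "\<And>x y. x \<in> S \<Longrightarrow> y \<in> S \<Longrightarrow> x \<otimes> y \<in> S"
    and S: "S \<subseteq> carrier R" and disj: "J \<inter> S = {}"
  obtains M where "primeideal M R" "J \<subseteq> M" "M \<inter> S = {}"
proof -
  define F where "F = {K. ideal K R \<and> J \<subseteq> K \<and> K \<inter> S = {}}"
  have "\<exists>M\<in>F. \<forall>K\<in>F. M \<subseteq> K \<longrightarrow> K = M"
  proof (rule subset_Zorn)
    fix C assume C: "subset.chain F C"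
    show "\<exists>U\<in>F. \<forall>K\<in>C. K \<subseteq> U"
    proof (cases "C = {}")
      case True
      \<comment> \<open>The union of the empty chain need not lie in \<open>F\<close>, so
        \<open>J\<close> itself serves as the bound.\<close>
      then show ?thesis using J disj by (auto simp: F_def)
    next
      case False
      have "subset.chain {I. ideal I R} C"
        using C unfolding pred_on.chain_def F_def by auto
      then have "ideal (\<Union>C) R"
        using chain_Union_is_ideal[of C] False by simp
      moreover have "J \<subseteq> \<Union>C" "\<Union>C \<inter> S = {}"
        using C False unfolding pred_on.chain_def F_def by blast+
      ultimately show ?thesis by (auto simp: F_def)
    qed
  qed
  then obtain M where M: "ideal M R" "J \<subseteq> M" "M \<inter> S = {}"
    and max: "\<And>K. \<lbrakk>ideal K R; M \<subseteq> K; K \<inter> S = {}\<rbrakk> \<Longrightarrow> K = M"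
    unfolding F_def by (smt (verit) mem_Collect_eq order_trans)
  interpret M: ideal M R by fact
  \<comment> \<open>The colon ideal of \<open>M\<close> by \<open>x\<close> contains
    \<open>M\<close> and also \<open>y\<close>, which is outside \<open>M\<close>. By maximality it
    must therefore meet \<open>S\<close>.\<close>
  have colon: "\<exists>s\<in>S. x \<otimes> s \<in> M"
    if x: "x \<in> carrier R" and y: "y \<in> carrier R" "y \<notin> M" "x \<otimes> y \<in> M" for x y
  proof (rule ccontr)
    assume neg: "\<not> (\<exists>s\<in>S. x \<otimes> s \<in> M)"
    have "{z \<in> carrier R. x \<otimes> z \<in> M} = M"
    proof (rule max)
      show "ideal {z \<in> carrier R. x \<otimes> z \<in> M} R"
        by (rule M.helper_max_prime[OF cring_axioms x])
      show "M \<subseteq> {z \<in> carrier R. x \<otimes> z \<in> M}"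
        using M.I_l_closed M.Icarr x by blast
    qed (use neg in blast)
    then show False using y by blast
  qed
  have "primeideal M R"
  proof (rule primeidealI[OF M(1) cring_axioms])
    show "carrier R \<noteq> M" using one M(3) by auto
  next
    fix x y assume x: "x \<in> carrier R" and y: "y \<in> carrier R" and xy: "x \<otimes> y \<in> M"
    show "x \<in> M \<or> y \<in> M"
    proof (rule ccontr)
      assume neg: "\<not> (x \<in> M \<or> y \<in> M)"
      then obtain s where s: "s \<in> S" "x \<otimes> s \<in> M" using colon x y xy by blast
      then have "s \<otimes> x \<in> M" using x S m_comm by auto
      \<comment> \<open>A second use of \<open>colon\<close>, with \<open>s\<close> in the role of
        \<open>x\<close> and \<open>x\<close> in the role of \<open>y\<close>, yields a product of
        two elements of \<open>S\<close> inside \<open>M\<close>.\<close>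
      then obtain t where "t \<in> S" "s \<otimes> t \<in> M" using colon[of s x] s S x neg by blast
      then show False using mult s M(3) by blast
    qed
  qed
  then show thesis using that M by blast
qed

lemma (in cring) minimal_primes_separation:
  assumes J: "ideal J R" and P: "P \<in> minimal_primes R J" and Q: "Q \<in> minimal_primes R J"
    and "P \<noteq> Q"
  obtains s t where "s \<in> carrier R - P" "t \<in> carrier R - Q" "s \<otimes> t \<in> J"
proof (rule ccontr)
  assume "\<not> thesis"
  then have neg: "\<And>s t. \<lbrakk>s \<in> carrier R - P; t \<in> carrier R - Q\<rbrakk> \<Longrightarrow> s \<otimes> t \<notin> J"
    using that by blast
  have pP: "primeideal P R" and pQ: "primeideal Q R"
    using P Q by (auto simp: minimal_primes_def)
  interpret P: primeideal P R by fact
  interpret Q: primeideal Q R by fact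
  have oP: "\<one> \<notin> P" and oQ: "\<one> \<notin> Q"
    using P.one_imp_carrier P.I_notcarr Q.one_imp_carrier Q.I_notcarr by auto
  define S where "S = {s \<otimes> t | s t. s \<in> carrier R - P \<and> t \<in> carrier R - Q}"
  obtain M where M: "primeideal M R" "J \<subseteq> M" "M \<inter> S = {}"
  proof (rule primeideal_avoiding_exists[OF J, of S])
    have "\<one> \<otimes> \<one> \<in> S" unfolding S_def using oP oQ by blast
    then show "\<one> \<in> S" by simp
    show "S \<subseteq> carrier R" unfolding S_def by auto
    show "J \<inter> S = {}" unfolding S_def using neg by blast
  next
    fix x y assume "x \<in> S" "y \<in> S"
    then obtain s t u v where st: "s \<in> carrier R - P" "t \<in> carrier R - Q" "x = s \<otimes> t"
      and uv: "u \<in> carrier R - P" "v \<in> carrier R - Q" "y = u \<otimes> v"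
      unfolding S_def by blast
    have "x \<otimes> y = (s \<otimes> u) \<otimes> (t \<otimes> v)"
      using st uv by (simp add: m_ac)
    moreover have "s \<otimes> u \<in> carrier R - P" "t \<otimes> v \<in> carrier R - Q"
      using st uv P.I_prime Q.I_prime by auto
    ultimately show "x \<otimes> y \<in> S" unfolding S_def by blast
  qed
  have "M \<subseteq> carrier R"
    using M(1) by (meson ideal.Icarr primeideal.axioms(1) subsetI)
  \<comment> \<open>Since \<open>\<one>\<close> avoids both primes, \<open>S\<close> contains each
    complement. So \<open>M\<close>, which misses \<open>S\<close>, lies in both primes and by
    minimality equals both.\<close>
  moreover have "x \<in> S" if "x \<in> carrier R - P" for x
  proof -
    have "x \<otimes> \<one> \<in> S" unfolding S_def using that oQ by blast
    then show ?thesis using that by simp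
  qed
  moreover have "x \<in> S" if "x \<in> carrier R - Q" for x
  proof -
    have "\<one> \<otimes> x \<in> S" unfolding S_def using that oP by blast
    then show ?thesis using that by simp
  qed
  ultimately have "M \<subseteq> P" "M \<subseteq> Q" using M(3) by blast+
  then have "M = P" "M = Q" using P Q M by (auto simp: minimal_primes_def)
  then show False using \<open>P \<noteq> Q\<close> by simp
qed

lemma (in primeideal) add_notin:
  assumes "x \<in> carrier R - I" "y \<in> I"
  shows "x \<oplus> y \<in> carrier R - I" "y \<oplus> x \<in> carrier R - I"
proof -
  have carr: "x \<in> carrier R" "y \<in> carrier R" using assms Icarr by auto
  have "x \<oplus> y \<notin> I"
  proof
    assume "x \<oplus> y \<in> I"
    then have "(x \<oplus> y) \<oplus> (\<ominus> y) \<in> I" using assms by (simp add: a_closed a_inv_closed)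
    then show False using assms carr by (simp add: a_assoc r_neg)
  qed
  then show "x \<oplus> y \<in> carrier R - I" "y \<oplus> x \<in> carrier R - I"
    using carr by (simp_all add: a_comm)
qed

lemma (in cring) ta_ideal_no_three_minimal_primes:
  assumes ta: "ta_ideal R J"
    and P: "P \<in> minimal_primes R J" and Q: "Q \<in> minimal_primes R J"
    and T: "T \<in> minimal_primes R J"
    and neq: "P \<noteq> Q" "P \<noteq> T" "Q \<noteq> T"
  shows False
proof -
  have J: "ideal J R" using ta by (simp add: ta_ideal_def)
  interpret J: ideal J R by fact
  have pP: "primeideal P R" "J \<subseteq> P" and pQ: "primeideal Q R" "J \<subseteq> Q"
    and pT: "primeideal T R" "J \<subseteq> T"
    using P Q T by (auto simp: minimal_primes_def)
  interpret P: primeideal P R by fact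
  interpret Q: primeideal Q R by fact
  interpret T: primeideal T R by fact
  obtain s1 t1 where 1: "s1 \<in> carrier R - P" "t1 \<in> carrier R - Q" "s1 \<otimes> t1 \<in> J"
    using minimal_primes_separation[OF J P Q neq(1)] .
  obtain s2 t2 where 2: "s2 \<in> carrier R - P" "t2 \<in> carrier R - T" "s2 \<otimes> t2 \<in> J"
    using minimal_primes_separation[OF J P T neq(2)] .
  obtain s3 t3 where 3: "s3 \<in> carrier R - Q" "t3 \<in> carrier R - T" "s3 \<otimes> t3 \<in> J"
    using minimal_primes_separation[OF J Q T neq(3)] .
  \<comment> \<open>Grouping by prime: \<open>a\<close> collects the elements chosen outside
    \<open>P\<close>, \<open>b\<close> those outside \<open>Q\<close>, \<open>c\<close> those
    outside \<open>T\<close>. Any two of the three then share a pair \<open>si\<close>,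
    \<open>ti\<close> with product in \<open>J\<close>.\<close>
  define a where "a = s1 \<otimes> s2"
  define b where "b = t1 \<otimes> s3"
  define c where "c = t2 \<otimes> t3"
  have a: "a \<in> carrier R - P" and b: "b \<in> carrier R - Q" and c: "c \<in> carrier R - T"
    unfolding a_def b_def c_def using 1 2 3 P.I_prime Q.I_prime T.I_prime
    by (meson DiffD1 DiffD2 DiffI m_closed)+
  have carr: "a \<in> carrier R" "b \<in> carrier R" "c \<in> carrier R" using a b c by auto
  have "a \<otimes> b = (s2 \<otimes> s3) \<otimes> (s1 \<otimes> t1)" "a \<otimes> c = (s1 \<otimes> t3) \<otimes> (s2 \<otimes> t2)"
    "b \<otimes> c = (t1 \<otimes> t2) \<otimes> (s3 \<otimes> t3)"
    using 1 2 3 by (simp_all add: a_def b_def c_def m_ac)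
  then have ab: "a \<otimes> b \<in> J" and ac: "a \<otimes> c \<in> J" and bc: "b \<otimes> c \<in> J"
    using 1 2 3 J.I_l_closed by auto
  \<comment> \<open>As \<open>P\<close> contains \<open>a \<otimes> b\<close> and
    \<open>a \<otimes> c\<close> but not \<open>a\<close>, it contains \<open>b\<close> and
    \<open>c\<close>. Hence \<open>a \<oplus> b\<close> and \<open>a \<oplus> c\<close> both avoid
    \<open>P\<close>, and so does their product. The same argument serves \<open>Q\<close> and
    \<open>T\<close>.\<close>
  have "b \<in> P" "c \<in> P"
    using P.I_prime[of a b] P.I_prime[of a c] ab ac a carr pP(2) by auto
  then have "(a \<oplus> b) \<otimes> (a \<oplus> c) \<notin> J"
    using P.I_prime[of "a \<oplus> b" "a \<oplus> c"] P.add_notin[OF a] pP(2) by blast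
  moreover have "a \<in> Q" "c \<in> Q"
    using Q.I_prime[of a b] Q.I_prime[of b c] ab bc b carr pQ(2) by auto
  then have "(a \<oplus> b) \<otimes> (b \<oplus> c) \<notin> J"
    using Q.I_prime[of "a \<oplus> b" "b \<oplus> c"] Q.add_notin[OF b] pQ(2) by blast
  moreover have "a \<in> T" "b \<in> T"
    using T.I_prime[of a c] T.I_prime[of b c] ac bc c carr pT(2) by auto
  then have "(a \<oplus> c) \<otimes> (b \<oplus> c) \<notin> J"
    using T.I_prime[of "a \<oplus> c" "b \<oplus> c"] T.add_notin[OF c] pT(2) by blast
  \<comment> \<open>The monomial \<open>abc\<close> occurs exactly twice in the expansion. It is
    charged to \<open>a \<otimes> b\<close> and to \<open>b \<otimes> c\<close>, which is why the
    cofactor of \<open>a \<otimes> c\<close> has no \<open>b\<close>.\<close>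
  moreover have "(a \<oplus> b) \<otimes> (a \<oplus> c) \<otimes> (b \<oplus> c) =
      (a \<oplus> b \<oplus> c) \<otimes> (a \<otimes> b) \<oplus> (a \<oplus> c) \<otimes> (a \<otimes> c) \<oplus> (a \<oplus> b \<oplus> c) \<otimes> (b \<otimes> c)"
    using carr by (simp add: l_distr r_distr m_ac a_ac)
  then have "(a \<oplus> b) \<otimes> (a \<oplus> c) \<otimes> (b \<oplus> c) \<in> J"
    using ab ac bc carr by (simp add: J.I_l_closed)
  moreover have "a \<oplus> b \<in> carrier R" "a \<oplus> c \<in> carrier R" "b \<oplus> c \<in> carrier R"
    using carr by simp_all
  ultimately show False
    using ta unfolding ta_ideal_def by blast
qed

lemma (in cring) finite_minimal_primes_ta_ideal:
  assumes "ta_ideal R J"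
  shows "finite (minimal_primes R J)"
proof (rule ccontr)
  assume "infinite (minimal_primes R J)"
  then obtain B where "B \<subseteq> minimal_primes R J" "card B = 3"
    using infinite_arbitrarily_large by blast
  moreover from this(2) obtain P Q T where "B = {P, Q, T}" "P \<noteq> Q" "P \<noteq> T" "Q \<noteq> T"
    by (auto simp: card_3_iff)
  ultimately show False
    using ta_ideal_no_three_minimal_primes[OF assms, of P Q T] by auto
qed

lemma (in ring) ideal_prod_list_ideal:
  assumes "\<forall>J\<in>set Js. ideal J R"
  shows "ideal (ideal_prod_list R Js) R"
  using assms by (induction Js) (auto simp: ideal_prod_list_def oneideal ideal_prod_is_ideal)

lemma (in ring) ideal_prod_list_subset:
  assumes "\<forall>J\<in>set Js. ideal J R" and "J \<in> set Js"
  shows "ideal_prod_list R Js \<subseteq> J"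
  using assms
proof (induction Js)
  case (Cons K Js)
  have "ideal_prod_list R (K # Js) \<subseteq> K \<inter> ideal_prod_list R Js"
    using ideal_prod_inter[of K "ideal_prod_list R Js"] ideal_prod_list_ideal[of Js] Cons.prems
    by (simp add: ideal_prod_list_def)
  then show ?case using Cons by auto
qed simp

lemma (in ring) primeideal_divides_ideal_prod_list:
  assumes P: "primeideal P R" and "\<forall>J\<in>set Js. ideal J R" and "ideal_prod_list R Js \<subseteq> P"
  shows "\<exists>J\<in>set Js. J \<subseteq> P"
  using assms(2,3)
proof (induction Js)
  \<comment> \<open>The empty product is the whole ring, which no prime contains, so this case is
    vacuous.\<close>
  case Nil
  then show ?case
    using primeideal.I_notcarr[OF P] ideal.Icarr[OF primeideal.axioms(1)[OF P]]
    by (auto simp: ideal_prod_list_def)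
next
  case (Cons K Js)
  have "K \<subseteq> P \<or> ideal_prod_list R Js \<subseteq> P"
    using primeideal_divides_ideal_prod[OF P, of K "ideal_prod_list R Js"]
      ideal_prod_list_ideal[of Js] Cons.prems
    by (simp add: ideal_prod_list_def)
  then show ?case using Cons by auto
qed

text \<open>A prime over the product contains some factor \<open>J\<close>. Any prime between
  \<open>J\<close> and \<open>P\<close> also contains the product, so minimality of \<open>P\<close>
  over the product passes to \<open>J\<close>.\<close>

lemma (in ring) minimal_primes_ideal_prod_list:
  assumes "\<forall>J\<in>set Js. ideal J R"
  shows "minimal_primes R (ideal_prod_list R Js) \<subseteq> (\<Union>J\<in>set Js. minimal_primes R J)"
proof
  fix P assume P: "P \<in> minimal_primes R (ideal_prod_list R Js)"
  then obtain J where J: "J \<in> set Js" "J \<subseteq> P"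
    using primeideal_divides_ideal_prod_list[of P Js] assms by (auto simp: minimal_primes_def)
  have "Q = P" if "primeideal Q R" "J \<subseteq> Q" "Q \<subseteq> P" for Q
  proof -
    have "ideal_prod_list R Js \<subseteq> Q"
      using ideal_prod_list_subset[OF assms J(1)] that(2) by (rule subset_trans)
    then show ?thesis using P that by (simp add: minimal_primes_def)
  qed
  then have "P \<in> minimal_primes R J"
    using P J(2) by (simp add: minimal_primes_def)
  then show "P \<in> (\<Union>J\<in>set Js. minimal_primes R J)" using J by blast
qed

theorem proposition2p2:
  fixes R :: "('a, 'b) ring_scheme" and I :: "'a set"
  assumes "taf_ring R"
    and "proper_ideal R I"
  shows "finite (minimal_primes R I)"
proof -
  interpret cring R using assms(1) by (simp add: taf_ring_def)
  obtain Js where Js: "ta_factorization R I Js"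
    using assms by (auto simp: taf_ring_def)
  then have ta: "\<forall>J\<in>set Js. ta_ideal R J" and I: "I = ideal_prod_list R Js"
    by (auto simp: ta_factorization_def)
  have "minimal_primes R I \<subseteq> (\<Union>J\<in>set Js. minimal_primes R J)"
    using minimal_primes_ideal_prod_list[of Js] ta I by (auto simp: ta_ideal_def)
  moreover have "finite (\<Union>J\<in>set Js. minimal_primes R J)"
    using ta finite_minimal_primes_ta_ideal by auto
  ultimately show ?thesis by (rule finite_subset)
qed

end
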